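(* Let $E$ be a $1$-Plichko Banach space of density $\aleph_1$. Then every $1$-complemented subspace of $E$ is $1$-Plichko.
   Context: A subspace $F$ of a Banach space $E$ is $1$-complemented if there is a linear projection $P\colon E\to E$ with $F=PE$ and $\|P\|\leqslant1$. A projectional resolution of the identity (PRI) in a Banach space $E$ of density $\aleph_1$ is a sequence $\{P_\alpha\}_{\alpha<\omega_1}$ of linear projections of $E$ onto separable subspaces such that (1) $\|P_\alpha\|=1$; (2) $\alpha\leqslant\beta$ implies $P_\alpha=P_\alpha P_\beta=P_\beta P_\alpha$; (3) $E=\bigcup_{\alpha<\omega_1}P_\alpha E$ and $P_\delta E=\operatorname{cl}(\bigcup_{\xi<\delta}P_\xi E)$ for every limit ordinal $\delta<\omega_1$. A Banach space of density $\aleph_1$ is $1$-Plichko if it has a PRI. Every separable Banach space counts as $1$-Plichko. *)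

theory Defs
  imports "HOL-Analysis.Analysis"
begin

unbundle cardinal_syntax

text \<open>
  Banach spaces are real. A Banach space is represented by a closed linear subspace \<open>E\<close> of a type
  of class \<^class>\<open>banach\<close>, with the full space being \<open>UNIV\<close>. This gives a subspace and the whole
  space the same notions. Operators on \<open>E\<close> are functions considered on \<open>E\<close> only: no extension
  to the ambient space is assumed.
\<close>

text \<open>
  The least uncountable cardinal, taken with its well-order. Its field is the index set of the
  ordinals \<open>\<alpha> < \<omega>\<^sub>1\<close>, and \<open>(\<alpha>, \<beta>) \<in> omega1\<close> means \<open>\<alpha> \<le> \<beta>\<close>.
\<close>
abbreviation omega1 :: "nat set rel" where
  "omega1 \<equiv> cardSuc natLeq"

text \<open>The least element does not count as a limit.\<close>
definition is_limit :: "'i rel \<Rightarrow> 'i \<Rightarrow> bool" where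
  "is_limit r \<delta> \<longleftrightarrow> \<delta> \<in> Field r \<and> underS r \<delta> \<noteq> {} \<and>
     (\<forall>\<xi>\<in>underS r \<delta>. \<exists>\<eta>\<in>underS r \<delta>. \<xi> \<in> underS r \<eta>)"

text \<open>The density of \<open>E\<close> (least cardinality of a dense subset) is the cardinal \<open>\<kappa>\<close>.\<close>
definition has_density :: "'a::topological_space set \<Rightarrow> 'k rel \<Rightarrow> bool" where
  "has_density E \<kappa> \<longleftrightarrow>
     (\<exists>D\<subseteq>E. top_of_set E closure_of D = E \<and> |D| =o \<kappa>) \<and>
     (\<forall>D\<subseteq>E. top_of_set E closure_of D = E \<longrightarrow> \<kappa> \<le>o |D| )"

definition bounded_linear_op_on :: "'a::real_normed_vector set \<Rightarrow> ('a \<Rightarrow> 'a) \<Rightarrow> bool" where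
  "bounded_linear_op_on E f \<longleftrightarrow>
     f ` E \<subseteq> E \<and>
     (\<forall>x\<in>E. \<forall>y\<in>E. f (x + y) = f x + f y) \<and>
     (\<forall>c. \<forall>x\<in>E. f (c *\<^sub>R x) = c *\<^sub>R f x) \<and>
     (\<exists>K. \<forall>x\<in>E. norm (f x) \<le> K * norm x)"

text \<open>The operator norm on \<open>E\<close>, meaningful for bounded operators only, as for \<^const>\<open>onorm\<close>.\<close>
definition onorm_on :: "'a::real_normed_vector set \<Rightarrow> ('a \<Rightarrow> 'a) \<Rightarrow> real" where
  "onorm_on E f = (SUP x\<in>E. norm (f x) / norm x)"

lemma bounded_linear_op_on_UNIV: "bounded_linear_op_on UNIV f \<longleftrightarrow> bounded_linear f"
  by (auto simp: bounded_linear_op_on_def bounded_linear_def bounded_linear_axioms_def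
      linear_iff mult.commute)

lemma onorm_on_UNIV: "onorm_on UNIV f = onorm f"
  by (simp add: onorm_on_def onorm_def)

definition projectional_resolution ::
    "'a::banach set \<Rightarrow> (nat set \<Rightarrow> 'a \<Rightarrow> 'a) \<Rightarrow> bool" where
  "projectional_resolution E P \<longleftrightarrow>
     (\<forall>\<alpha>\<in>Field omega1.
        bounded_linear_op_on E (P \<alpha>) \<and>
        (\<forall>x\<in>E. P \<alpha> (P \<alpha> x) = P \<alpha> x) \<and>
        separable_space (top_of_set (P \<alpha> ` E)) \<and>
        onorm_on E (P \<alpha>) = 1) \<and>
     (\<forall>\<alpha> \<beta>. (\<alpha>, \<beta>) \<in> omega1 \<longrightarrow>
        (\<forall>x\<in>E. P \<alpha> x = P \<alpha> (P \<beta> x) \<and> P \<alpha> x = P \<beta> (P \<alpha> x))) \<and>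
     E = (\<Union>\<alpha>\<in>Field omega1. P \<alpha> ` E) \<and>
     (\<forall>\<delta>. is_limit omega1 \<delta> \<longrightarrow>
        P \<delta> ` E = closure (\<Union>\<xi>\<in>underS omega1 \<delta>. P \<xi> ` E))"

definition one_Plichko :: "'a::banach set \<Rightarrow> bool" where
  "one_Plichko E \<longleftrightarrow> subspace E \<and> closed E \<and>
     (separable_space (top_of_set E) \<or>
      has_density E omega1 \<and> (\<exists>P. projectional_resolution E P))"

definition one_complemented :: "'a::banach set \<Rightarrow> bool" where
  "one_complemented F \<longleftrightarrow> subspace F \<and>
     (\<exists>P. bounded_linear P \<and> P \<circ> P = P \<and> range P = F \<and> onorm P \<le> 1)"

end

theory Submission
  imports Defs
begin

text \<open>
  Let \<open>P\<close> be a projectional resolution of the whole space and \<open>R\<close> a contractive projection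
  onto \<open>F\<close>. A closing-off argument shows that the ranges \<open>G\<close> of the \<open>P\<^sub>\<alpha>\<close> with \<open>R G \<subseteq> G\<close> are cofinal
  among all the ranges and stable under closures of bounded unions. Their traces \<open>F \<inter> G = R G\<close> form a
  chain of separable subspaces with union \<open>F\<close>, continuous and well-ordered by inclusion, and
  \<open>R P\<^sub>\<alpha>\<close> is a contractive projection onto the trace of \<open>G = P\<^sub>\<alpha> E\<close>. However, the maps \<open>R P\<^sub>\<alpha>\<close> need
  not commute: although the ranges are nested, the kernels may fail to be.

  Commutation is restored by using each \<open>R P\<^sub>\<alpha>\<close> on one step of the chain only, from a trace \<open>H'\<close>
  to the trace \<open>H\<close> just below it, and composing these steps along the chain. No
  recursion is needed, as the composite onto a member \<open>G\<close> is the projection along the closed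
  span of all the kernels \<open>{x - Q\<^sub>H x | x \<in> H'}\<close> of the steps above \<open>G\<close>, where \<open>Q\<^sub>H\<close> is the given
  projection onto \<open>H\<close>. That this span is a complement of \<open>G\<close>, and that the projection along
  it is a contraction, follows from two facts:
  \<^item> \<open>norm y \<le> norm (y + k)\<close> for \<open>y \<in> G\<close> and \<open>k\<close> in the span (\<open>norm_le_add_span_defects\<close>), because
    applying the steps from the top down deletes the summands of \<open>k\<close> one after the other;
  \<^item> every member of the chain lies in \<open>G\<close> plus the complement (\<open>decomposition\<close>), by transfinite
    induction along the chain.

  The complements shrink as \<open>G\<close> grows, so both the ranges and the kernels are nested, and the
  projections commute. The chain is finally indexed by all of \<open>\<omega>\<^sub>1\<close> by sending \<open>\<alpha>\<close> to the least
  invariant range that contains \<open>P\<^sub>\<alpha> E\<close>.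
\<close>

section \<open>Closed subspaces and projections\<close>

lemma subspace_closure:
  fixes S :: "'a::real_normed_vector set"
  assumes S: "subspace S"
  shows "subspace (closure S)"
  unfolding subspace_def
proof (intro conjI ballI allI)
  show "0 \<in> closure S" using subspace_0[OF S] closure_subset by blast
next
  fix x y assume "x \<in> closure S" "y \<in> closure S"
  then obtain f g where f: "\<And>n. f n \<in> S" "f \<longlonglongrightarrow> x" and g: "\<And>n. g n \<in> S" "g \<longlonglongrightarrow> y"
    unfolding closure_sequential by blast
  show "x + y \<in> closure S"
    unfolding closure_sequential
    by (rule exI[of _ "\<lambda>n. f n + g n"]) (auto intro: tendsto_add f g subspace_add[OF S])
next
  fix c x assume "x \<in> closure S"
  then obtain f where f: "\<And>n. f n \<in> S" "f \<longlonglongrightarrow> x"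
    unfolding closure_sequential by blast
  show "c *\<^sub>R x \<in> closure S"
    unfolding closure_sequential
    by (rule exI[of _ "\<lambda>n. c *\<^sub>R f n"]) (auto intro: tendsto_scaleR f subspace_scale[OF S])
qed

text \<open>
  By the inequality, the \<open>Y\<close>-components of a Cauchy sequence in the sum are again Cauchy, so the
  two components converge separately.
\<close>
lemma closed_subspace_sum:
  fixes Y K :: "'a::banach set"
  assumes Y: "subspace Y" "closed Y" and K: "subspace K" "closed K"
    and le: "\<And>y k. \<lbrakk>y \<in> Y; k \<in> K\<rbrakk> \<Longrightarrow> norm y \<le> norm (y + k)"
  shows "closed {y + k | y k. y \<in> Y \<and> k \<in> K}"
  unfolding closed_sequential_limits
proof (intro allI impI, elim conjE)
  fix f l assume "\<forall>n. f n \<in> {y + k | y k. y \<in> Y \<and> k \<in> K}" and lim: "f \<longlonglongrightarrow> l"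
  then have "\<forall>n. \<exists>y k. f n = y + k \<and> y \<in> Y \<and> k \<in> K" by auto
  then obtain y k where f: "\<And>n. f n = y n + k n" and y: "\<And>n. y n \<in> Y" and k: "\<And>n. k n \<in> K"
    by metis
  have "norm (y m - y n) \<le> norm (f m - f n)" for m n
    using le[OF subspace_diff[OF Y(1) y y] subspace_diff[OF K(1) k k], of m n m n]
    by (simp add: f algebra_simps)
  moreover have "Cauchy f" using lim by (rule LIMSEQ_imp_Cauchy)
  ultimately have "Cauchy y"
    unfolding Cauchy_def dist_norm by (meson order.strict_trans1)
  then obtain b where b: "y \<longlonglongrightarrow> b" using Cauchy_convergent convergent_def by blast
  have "(\<lambda>n. f n - y n) \<longlonglongrightarrow> l - b" using lim b by (rule tendsto_diff)
  then have "k \<longlonglongrightarrow> l - b" by (simp add: f)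
  then have "l - b \<in> K" using K(2) k closed_sequentially by blast
  moreover have "b \<in> Y" using Y(2) y b closed_sequentially by blast
  ultimately show "l \<in> {y + k | y k. y \<in> Y \<and> k \<in> K}" by force
qed

lemma closed_range_idempotent:
  fixes f :: "'a::real_normed_vector \<Rightarrow> 'a"
  assumes "bounded_linear f" and idem: "\<And>x. f (f x) = f x"
  shows "closed (range f)"
proof -
  have "range f = {x. f x = x}"
  proof (intro set_eqI iffI)
    fix x assume "x \<in> {x. f x = x}"
    then have "x = f x" by simp
    then show "x \<in> range f" by (rule range_eqI)
  qed (use idem in auto)
  moreover have "closed {x. f x = x}"
    by (intro closed_Collect_eq linear_continuous_on continuous_on_id assms)
  ultimately show ?thesis by simp
qed

section \<open>Commuting projections from a chain of complemented subspaces\<close>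

text \<open>
  A continuous chain of subspaces, well-ordered by inclusion, with contractive projections \<open>Q H\<close>
  defined on the whole space. No relation between the projections onto different members is
  assumed. Ordering the subspaces themselves by inclusion replaces the ordinal indices, so
  successors and limits of members are expressed through inclusion.
\<close>
locale contractive_chain =
  fixes \<C> :: "'a::banach set set" and Q :: "'a set \<Rightarrow> 'a \<Rightarrow> 'a"
  assumes least: "\<lbrakk>\<D> \<subseteq> \<C>; \<D> \<noteq> {}\<rbrakk> \<Longrightarrow> \<exists>G\<in>\<D>. \<forall>H\<in>\<D>. G \<subseteq> H"
    and closure_Union: "\<lbrakk>\<D> \<subseteq> \<C>; \<D> \<noteq> {}; U \<in> \<C>; \<Union>\<D> \<subseteq> U\<rbrakk> \<Longrightarrow> closure (\<Union>\<D>) \<in> \<C>"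
    and linear_Q: "H \<in> \<C> \<Longrightarrow> linear (Q H)"
    and range_Q: "H \<in> \<C> \<Longrightarrow> Q H x \<in> H"
    and fixed_Q: "\<lbrakk>H \<in> \<C>; x \<in> H\<rbrakk> \<Longrightarrow> Q H x = x"
    and norm_Q: "H \<in> \<C> \<Longrightarrow> norm (Q H x) \<le> norm x"
begin

lemma chain: "\<lbrakk>G \<in> \<C>; H \<in> \<C>\<rbrakk> \<Longrightarrow> G \<subseteq> H \<or> H \<subseteq> G"
  using least[of "{G, H}"] by auto

lemma range_Q_eq:
  assumes "H \<in> \<C>"
  shows "range (Q H) = H"
proof
  show "range (Q H) \<subseteq> H" using range_Q[OF assms] by auto
  show "H \<subseteq> range (Q H)" using fixed_Q[OF assms] by (metis rangeI subsetI)
qed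

lemma subspace: "H \<in> \<C> \<Longrightarrow> subspace H"
  using linear_subspace_image[OF linear_Q subspace_UNIV] range_Q_eq by metis

lemma closed:
  assumes "H \<in> \<C>"
  shows "closed H"
proof -
  have "bounded_linear (Q H)"
    by (rule bounded_linear_intro[where K = 1])
      (use linear_add[OF linear_Q[OF assms]] linear_scale[OF linear_Q[OF assms]] norm_Q[OF assms] in auto)
  then have "closed (range (Q H))"
    by (rule closed_range_idempotent) (rule fixed_Q[OF assms range_Q[OF assms]])
  then show ?thesis using range_Q_eq[OF assms] by simp
qed

text \<open>
  The condition on \<open>H'\<close> says that \<open>H'\<close> is the immediate successor of \<open>H\<close> in the chain, or
  \<open>H' \<subseteq> H\<close>, when \<open>x - Q H x\<close> is \<open>0\<close>. So the elements are those killed by some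
  step of the chain above \<open>G\<close>, from \<open>H'\<close> down to \<open>H\<close>.
\<close>
definition defects :: "'a set \<Rightarrow> 'a set" where
  "defects G = {x - Q H x | H H' x.
     H \<in> \<C> \<and> G \<subseteq> H \<and> H' \<in> \<C> \<and> x \<in> H' \<and> (\<forall>L\<in>\<C>. L \<subset> H' \<longrightarrow> L \<subseteq> H)}"

lemma defectsI:
  assumes "H \<in> \<C>" "G \<subseteq> H" "H' \<in> \<C>" "x \<in> H'" "\<And>L. \<lbrakk>L \<in> \<C>; L \<subset> H'\<rbrakk> \<Longrightarrow> L \<subseteq> H"
  shows "x - Q H x \<in> defects G"
  unfolding defects_def mem_Collect_eq
  by (intro exI[of _ H] exI[of _ H'] exI[of _ x] conjI ballI impI assms refl)

lemma defectsE:
  assumes "b \<in> defects G"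
  obtains H H' x where "b = x - Q H x" "H \<in> \<C>" "G \<subseteq> H" "H' \<in> \<C>" "x \<in> H'"
    "\<And>L. \<lbrakk>L \<in> \<C>; L \<subset> H'\<rbrakk> \<Longrightarrow> L \<subseteq> H"
  using assms unfolding defects_def mem_Collect_eq
proof (elim exE conjE)
  fix H H' x
  assume *: "b = x - Q H x" "H \<in> \<C>" "G \<subseteq> H" "H' \<in> \<C>" "x \<in> H'"
    and gap: "\<forall>L\<in>\<C>. L \<subset> H' \<longrightarrow> L \<subseteq> H"
  show thesis by (rule that[OF *]) (use gap in simp)
qed

lemma defects_antimono: "G \<subseteq> H \<Longrightarrow> defects H \<subseteq> defects G"
proof
  fix b assume "G \<subseteq> H" "b \<in> defects H"
  from this(2) show "b \<in> defects G"
  proof (rule defectsE)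
    fix L H' x assume *: "b = x - Q L x" "L \<in> \<C>" "H \<subseteq> L" "H' \<in> \<C>" "x \<in> H'"
      "\<And>M. \<lbrakk>M \<in> \<C>; M \<subset> H'\<rbrakk> \<Longrightarrow> M \<subseteq> L"
    have "G \<subseteq> L" using \<open>G \<subseteq> H\<close> *(3) by (rule order_trans)
    then show "b \<in> defects G" unfolding *(1) by (rule defectsI[OF *(2) _ *(4,5,6)])
  qed
qed

definition complement :: "'a set \<Rightarrow> 'a set" where
  "complement G = closure (span (defects G))"

text \<open>
  Let \<open>H\<close> be the largest index that occurs in a linear combination of defects. Summands with a
  smaller index lie in \<open>H\<close>, because their step ends at or below \<open>H\<close>; so does \<open>y\<close>. Hence \<open>Q H\<close>
  fixes these and kills the summands with index \<open>H\<close>. Being a contraction, it shows that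
  deleting the latter does not increase the norm, and the number of summands decreases.
\<close>
lemma norm_le_add_span_defects:
  assumes G: "G \<in> \<C>" and y: "y \<in> G" and k: "k \<in> span (defects G)"
  shows "norm y \<le> norm (y + k)"
proof -
  have sums: "norm y \<le> norm (y + (\<Sum>b\<in>t. r b *\<^sub>R b))" if "finite t" "t \<subseteq> defects G" for t and r :: "'a \<Rightarrow> real"
    using that
  proof (induction t rule: finite_psubset_induct)
    case (psubset t)
    show ?case
    proof (cases "t = {}")
      case False
      have "\<forall>b\<in>t. \<exists>H. H \<in> \<C> \<and> G \<subseteq> H \<and> (\<exists>H' x. b = x - Q H x \<and> H' \<in> \<C> \<and> x \<in> H'
          \<and> (\<forall>L\<in>\<C>. L \<subset> H' \<longrightarrow> L \<subseteq> H))"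
      proof
        fix b assume "b \<in> t"
        then have "b \<in> defects G" using psubset.prems by auto
        then show "\<exists>H. H \<in> \<C> \<and> G \<subseteq> H \<and> (\<exists>H' x. b = x - Q H x \<and> H' \<in> \<C> \<and> x \<in> H'
          \<and> (\<forall>L\<in>\<C>. L \<subset> H' \<longrightarrow> L \<subseteq> H))" by (rule defectsE) metis
      qed
      from bchoice[OF this] obtain h where h: "\<forall>b\<in>t. h b \<in> \<C> \<and> G \<subseteq> h b
          \<and> (\<exists>H' x. b = x - Q (h b) x \<and> H' \<in> \<C> \<and> x \<in> H' \<and> (\<forall>L\<in>\<C>. L \<subset> H' \<longrightarrow> L \<subseteq> h b))" ..
      have "finite (h ` t)" "h ` t \<noteq> {}" using psubset.hyps False by auto
      then obtain H where "H \<in> h ` t" and max: "\<And>L. L \<in> h ` t \<Longrightarrow> H \<subseteq> L \<Longrightarrow> H = L"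
        by (metis finite_has_maximal)
      then obtain a where a: "a \<in> t" "h a = H" by auto
      have H: "H \<in> \<C>" "G \<subseteq> H" using bspec[OF h a(1)] a(2) by auto
      interpret linear "Q H" by (rule linear_Q[OF H(1)])
      let ?s = "{b \<in> t. h b \<noteq> H}"
      \<comment> \<open>\<open>?s\<close> collects the summands below the top index; they survive \<open>Q H\<close> unchanged.\<close>
      have kill: "Q H b = 0" if "b \<in> t - ?s" for b
      proof -
        from that obtain x where "b = x - Q H x" using bspec[OF h, of b] by auto
        then show ?thesis using fixed_Q[OF H(1) range_Q[OF H(1)]] by (simp add: diff)
      qed
      have keep: "b \<in> H" if b: "b \<in> ?s" for b
      proof -
        from bspec[OF h, of b] b obtain H' x where bx: "b = x - Q (h b) x" "h b \<in> \<C>" "H' \<in> \<C>" "x \<in> H'"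
          and gap: "\<forall>L\<in>\<C>. L \<subset> H' \<longrightarrow> L \<subseteq> h b" by auto
        have lt: "h b \<subset> H" using chain[OF bx(2) H(1)] max[of "h b"] b by auto
        have "H' \<subseteq> H"
          using chain[OF bx(3) H(1)] gap H(1) lt by (metis psubsetE psubsetI subset_antisym subset_refl)
        then have "x \<in> H" "Q (h b) x \<in> H" using bx(4) range_Q[OF bx(2), of x] lt by blast+
        then have "x - Q (h b) x \<in> H" by (rule subspace_diff[OF subspace[OF H(1)]])
        then show ?thesis by (subst bx(1))
      qed
      have ps: "?s \<subset> t" using a by auto
      let ?z = "y + (\<Sum>b\<in>?s. r b *\<^sub>R b)"
      have z: "?z \<in> H"
        using y H(2) keep subspace[OF H(1)]
        by (intro subspace_add subspace_sum subspace_scale) auto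
      have "norm y \<le> norm ?z" using psubset.IH[OF ps] psubset.prems by auto
      also have "y + (\<Sum>b\<in>t. r b *\<^sub>R b) = ?z + (\<Sum>b\<in>t - ?s. r b *\<^sub>R b)"
        using sum.subset_diff[of ?s t "\<lambda>b. r b *\<^sub>R b"] psubset.hyps by (auto simp: algebra_simps)
      then have "Q H (y + (\<Sum>b\<in>t. r b *\<^sub>R b)) = Q H ?z + (\<Sum>b\<in>t - ?s. r b *\<^sub>R Q H b)"
        by (simp only: add sum scale)
      then have "Q H (y + (\<Sum>b\<in>t. r b *\<^sub>R b)) = ?z"
        using fixed_Q[OF H(1) z] kill by simp
      then have "norm ?z \<le> norm (y + (\<Sum>b\<in>t. r b *\<^sub>R b))" using norm_Q[OF H(1)] by metis
      finally show ?thesis .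
    qed simp
  qed
  from k obtain t r where "finite t" "t \<subseteq> defects G" "k = (\<Sum>b\<in>t. r b *\<^sub>R b)"
    unfolding span_explicit by blast
  then show ?thesis using sums by blast
qed

lemma norm_le_add_complement:
  assumes "G \<in> \<C>" "y \<in> G" "k \<in> complement G"
  shows "norm y \<le> norm (y + k)"
proof -
  have "closed {k. norm y \<le> norm (y + k)}"
    by (intro closed_Collect_le continuous_intros)
  then have "closure (span (defects G)) \<subseteq> {k. norm y \<le> norm (y + k)}"
    using norm_le_add_span_defects[OF assms(1,2)] by (intro closure_minimal) auto
  then show ?thesis using assms(3) unfolding complement_def by auto
qed

lemma subspace_complement: "subspace (complement G)"
  unfolding complement_def by (intro subspace_closure subspace_span)

lemma closed_complement: "closed (complement G)"
  unfolding complement_def by (rule closed_closure)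

lemma complement_antimono: "G \<subseteq> H \<Longrightarrow> complement H \<subseteq> complement G"
  unfolding complement_def by (intro closure_mono span_mono defects_antimono)

lemma defects_complement: "defects G \<subseteq> complement G"
  unfolding complement_def using span_superset closure_subset by blast

text \<open>
  A least member \<open>B\<close> violating the inclusion properly contains \<open>G\<close>. Let \<open>M\<close> be the closed union of
  all members below \<open>B\<close>. The sum \<open>?S\<close> is closed, so it contains \<open>M\<close>. Thus \<open>M \<noteq> B\<close>, which makes \<open>B\<close>
  the successor of \<open>M\<close>, and \<open>x = Q M x + (x - Q M x)\<close> puts every \<open>x \<in> B\<close> into \<open>?S\<close> after all.
\<close>
lemma decomposition:
  assumes G: "G \<in> \<C>" and H: "H \<in> \<C>"
  shows "H \<subseteq> {y + k | y k. y \<in> G \<and> k \<in> complement G}" (is "H \<subseteq> ?S")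
proof (rule ccontr)
  assume "\<not> H \<subseteq> ?S"
  let ?X = "{H \<in> \<C>. \<not> H \<subseteq> ?S}"
  have "\<exists>B\<in>?X. \<forall>L\<in>?X. B \<subseteq> L"
    by (rule least) (use H \<open>\<not> H \<subseteq> ?S\<close> in blast)+
  then obtain B where "B \<in> ?X" and first: "\<forall>L\<in>?X. B \<subseteq> L" by (rule bexE)
  then have B: "B \<in> \<C>" "\<not> B \<subseteq> ?S" by simp_all
  have K0: "0 \<in> complement G" by (rule subspace_0[OF subspace_complement])
  have GS: "G \<subseteq> ?S" using K0 by force
  then have GB: "G \<subset> B" using chain[OF G B(1)] B(2) by auto
  let ?D = "{L \<in> \<C>. L \<subset> B}"
  let ?M = "closure (\<Union>?D)"
  have MB: "?M \<subseteq> B" by (rule closure_minimal) (auto simp: closed B(1))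
  have M: "?M \<in> \<C>" by (rule closure_Union[OF _ _ B(1)]) (use G GB in auto)
  have closedS: "closed ?S"
    by (rule closed_subspace_sum[OF subspace[OF G] closed[OF G] subspace_complement closed_complement
          norm_le_add_complement[OF G]])
  have MS: "?M \<subseteq> ?S"
    by (rule closure_minimal[OF _ closedS]) (use first in blast)
  have below: "L \<subseteq> ?M" if "L \<in> \<C>" "L \<subset> B" for L
    using that closure_subset[of "\<Union>?D"] by blast
  have "B \<subseteq> ?S"
  proof
    fix x assume x: "x \<in> B"
    have "Q ?M x \<in> ?S" using range_Q[OF M] MS by blast
    then obtain y k where yk: "Q ?M x = y + k" "y \<in> G" "k \<in> complement G" by auto
    have "x - Q ?M x \<in> defects G"
      by (rule defectsI[OF M below[OF G GB] B(1) x below])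
    then have "k + (x - Q ?M x) \<in> complement G"
      using defects_complement yk(3) subspace_add[OF subspace_complement] by blast
    moreover have "x = y + (k + (x - Q ?M x))" using yk(1) by simp
    ultimately show "x \<in> ?S" using yk(2) by blast
  qed
  then show False using B(2) by simp
qed

text \<open>The projection onto \<open>G\<close> along its complement, meaningful on the union of the chain.\<close>
definition proj :: "'a set \<Rightarrow> 'a \<Rightarrow> 'a" where
  "proj G x = (SOME y. y \<in> G \<and> x - y \<in> complement G)"

lemma proj:
  assumes "G \<in> \<C>" "x \<in> \<Union>\<C>"
  shows "proj G x \<in> G" "x - proj G x \<in> complement G"
proof -
  obtain y k where "x = y + k" "y \<in> G" "k \<in> complement G"
    using decomposition[OF assms(1)] assms(2) by blast
  then have "\<exists>y. y \<in> G \<and> x - y \<in> complement G" by (intro exI[of _ y]) simp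
  from someI_ex[OF this] show "proj G x \<in> G" "x - proj G x \<in> complement G"
    unfolding proj_def by auto
qed

lemma proj_unique:
  assumes G: "G \<in> \<C>" and y: "y \<in> G" "x - y \<in> complement G"
  shows "proj G x = y"
proof -
  have p: "proj G x \<in> G" "x - proj G x \<in> complement G"
    using someI[of "\<lambda>y. y \<in> G \<and> x - y \<in> complement G", OF conjI[OF y]] unfolding proj_def by auto
  have "proj G x - y \<in> G" using subspace_diff[OF subspace[OF G] p(1) y(1)] .
  moreover have "(x - proj G x) - (x - y) \<in> complement G"
    using subspace_diff[OF subspace_complement p(2) y(2)] .
  ultimately have "norm (proj G x - y) \<le> norm ((proj G x - y) + ((x - proj G x) - (x - y)))"
    by (rule norm_le_add_complement[OF G])
  then show ?thesis by simp
qed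

lemma proj_fixed: "\<lbrakk>G \<in> \<C>; x \<in> G\<rbrakk> \<Longrightarrow> proj G x = x"
  by (rule proj_unique) (simp_all add: subspace_0[OF subspace_complement])

lemma proj_add:
  assumes "G \<in> \<C>" "x \<in> \<Union>\<C>" "y \<in> \<Union>\<C>"
  shows "proj G (x + y) = proj G x + proj G y"
proof (rule proj_unique[OF assms(1)])
  show "proj G x + proj G y \<in> G"
    using assms by (intro subspace_add subspace proj)
  have "(x - proj G x) + (y - proj G y) \<in> complement G"
    using assms by (intro subspace_add subspace_complement proj)
  then show "x + y - (proj G x + proj G y) \<in> complement G" by (simp add: algebra_simps)
qed

lemma proj_scale:
  assumes "G \<in> \<C>" "x \<in> \<Union>\<C>"
  shows "proj G (c *\<^sub>R x) = c *\<^sub>R proj G x"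
proof (rule proj_unique[OF assms(1)])
  show "c *\<^sub>R proj G x \<in> G"
    using assms by (intro subspace_scale subspace proj)
  have "c *\<^sub>R (x - proj G x) \<in> complement G"
    using assms by (intro subspace_scale subspace_complement proj)
  then show "c *\<^sub>R x - c *\<^sub>R proj G x \<in> complement G" by (simp add: algebra_simps)
qed

lemma norm_proj:
  assumes "G \<in> \<C>" "x \<in> \<Union>\<C>"
  shows "norm (proj G x) \<le> norm x"
  using norm_le_add_complement[OF assms(1) proj[OF assms]] by simp

text \<open>Commutation rests on the kernels being nested, by \<open>complement_antimono\<close>.\<close>
lemma proj_proj:
  assumes "G \<in> \<C>" "H \<in> \<C>" "G \<subseteq> H" "x \<in> \<Union>\<C>"
  shows "proj G (proj H x) = proj G x" "proj H (proj G x) = proj G x"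
proof -
  have Hx: "proj H x \<in> \<Union>\<C>" using proj(1)[OF assms(2,4)] assms(2) by blast
  have "(proj H x - proj G (proj H x)) + (x - proj H x) \<in> complement G"
    using proj(2)[OF assms(1) Hx] proj(2)[OF assms(2,4)] complement_antimono[OF assms(3)]
    by (intro subspace_add subspace_complement) auto
  then have "x - proj G (proj H x) \<in> complement G" by simp
  from proj_unique[OF assms(1) proj(1)[OF assms(1) Hx] this]
  show "proj G (proj H x) = proj G x" by simp
  show "proj H (proj G x) = proj G x"
    using proj_fixed[OF assms(2)] proj(1)[OF assms(1,4)] assms(3) by blast
qed

end


section \<open>Separability and density\<close>

lemma separable_space_iff:
  fixes S :: "'a::topological_space set"
  shows "separable_space (top_of_set S) \<longleftrightarrow> (\<exists>D\<subseteq>S. countable D \<and> S \<subseteq> closure D)"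
proof
  assume "separable_space (top_of_set S)"
  then obtain D where "countable D" "D \<subseteq> S" "S \<inter> closure (S \<inter> D) = S"
    by (auto simp: separable_space_def closure_of_subtopology)
  then show "\<exists>D\<subseteq>S. countable D \<and> S \<subseteq> closure D" by (metis Int_absorb1 inf.orderI)
next
  assume "\<exists>D\<subseteq>S. countable D \<and> S \<subseteq> closure D"
  then obtain D where "D \<subseteq> S" "countable D" "S \<subseteq> closure D" by auto
  then show "separable_space (top_of_set S)"
    unfolding separable_space_def by (intro exI[of _ D]) (auto simp: closure_of_subtopology Int_absorb1)
qed

lemma separable_image:
  assumes "separable_space (top_of_set S)" "continuous_on S f"
  shows "separable_space (top_of_set (f ` S))"
  by (rule separable_space_continuous_map_image[OF assms(1), of _ f]) (use assms(2) in auto)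

lemma onorm_on_eq_1:
  assumes "\<And>x. x \<in> F \<Longrightarrow> norm (f x) \<le> norm x" "x0 \<in> F" "f x0 = x0" "x0 \<noteq> 0"
  shows "onorm_on F f = 1"
  unfolding onorm_on_def
proof (rule cSup_eq_maximum)
  show "1 \<in> (\<lambda>x. norm (f x) / norm x) ` F" using assms by (intro image_eqI[of _ _ x0]) auto
  show "z \<le> 1" if "z \<in> (\<lambda>x. norm (f x) / norm x) ` F" for z
    using that assms(1) by (auto simp: divide_le_eq_1)
qed

lemma Well_order_omega1: "Well_order omega1"
  using cardSuc_Card_order[OF natLeq_Card_order] card_order_on_well_order_on by blast

lemma countable_iff_ordLeq_natLeq: "countable A \<longleftrightarrow> |A| \<le>o natLeq"
proof -
  have "countable A \<longleftrightarrow> |A| \<le>o |UNIV :: nat set|"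
    unfolding countable_def card_of_ordLeq[symmetric] by simp
  then show ?thesis
    using ordLeq_ordIso_trans card_of_nat ordIso_symmetric by blast
qed

text \<open>
  The image of a dense set of size \<open>\<aleph>\<^sub>1\<close> is dense in the image, which bounds the density above. A
  smaller dense set would be countable, against nonseparability.
\<close>
lemma has_density_omega1_nonseparable_image:
  fixes F :: "'a::topological_space set" and R :: "'a \<Rightarrow> 'a"
  assumes "has_density (UNIV :: 'a set) omega1" "continuous_on UNIV R" "range R = F"
    and nonsep: "\<not> separable_space (top_of_set F)"
  shows "has_density F omega1"
proof -
  have lower: "omega1 \<le>o |D|" if D: "D \<subseteq> F" "top_of_set F closure_of D = F" for D
  proof (rule ccontr)
    assume "\<not> omega1 \<le>o |D|"
    then have "|D| <o omega1"
      using Well_order_omega1 card_of_Well_order not_ordLeq_iff_ordLess by blast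
    then have "|D| \<le>o natLeq"
      using cardSuc_ordLeq_ordLess[OF natLeq_Card_order card_of_Card_order] by blast
    then have "countable D"
      by (simp add: countable_iff_ordLeq_natLeq)
    then show False using nonsep D unfolding separable_space_def by (metis topspace_euclidean_subtopology)
  qed
  obtain D where D: "closure D = (UNIV :: 'a set)" "|D| =o omega1"
    using assms(1) unfolding has_density_def by (auto simp: subtopology_UNIV)
  have "R ` closure D \<subseteq> closure (R ` D)"
    by (rule continuous_image_closure_subset[OF assms(2)]) simp
  then have dense: "top_of_set F closure_of (R ` D) = F"
    using assms(3) D by (auto simp: closure_of_subtopology Int_absorb1 image_mono)
  have sub: "R ` D \<subseteq> F" using assms(3) by auto
  have "|R ` D| \<le>o omega1" using card_of_image D(2) ordLeq_ordIso_trans by blast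
  then have "|R ` D| =o omega1" using lower[OF sub dense] ordIso_iff_ordLeq by blast
  then show ?thesis unfolding has_density_def using lower sub dense by blast
qed

section \<open>Ranges invariant under the projection\<close>

locale resolution_and_projection =
  fixes P :: "nat set \<Rightarrow> 'a::banach \<Rightarrow> 'a" and R :: "'a \<Rightarrow> 'a"
  assumes PRI: "projectional_resolution UNIV P"
    and R: "bounded_linear R" "\<And>x. R (R x) = R x" "\<And>x. norm (R x) \<le> norm x"
begin

definition \<E> :: "'a set set" where
  "\<E> = (\<lambda>\<alpha>. range (P \<alpha>)) ` Field omega1"

lemma \<E>I: "\<alpha> \<in> Field omega1 \<Longrightarrow> range (P \<alpha>) \<in> \<E>"
  unfolding \<E>_def by (rule imageI)

lemma \<E>E:
  assumes "G \<in> \<E>"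
  obtains \<alpha> where "\<alpha> \<in> Field omega1" "G = range (P \<alpha>)"
  using assms unfolding \<E>_def by (rule imageE)

lemma P:
  assumes "\<alpha> \<in> Field omega1"
  shows "bounded_linear (P \<alpha>)" "P \<alpha> (P \<alpha> x) = P \<alpha> x" "norm (P \<alpha> x) \<le> norm x"
    "separable_space (top_of_set (range (P \<alpha>)))"
proof -
  show bl: "bounded_linear (P \<alpha>)" and "P \<alpha> (P \<alpha> x) = P \<alpha> x"
    and "separable_space (top_of_set (range (P \<alpha>)))"
    using PRI assms by (auto simp: projectional_resolution_def bounded_linear_op_on_UNIV)
  have "onorm (P \<alpha>) = 1"
    using PRI assms by (auto simp: projectional_resolution_def onorm_on_UNIV)
  then show "norm (P \<alpha> x) \<le> norm x" using onorm[OF bl, of x] by simp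
qed

lemma closed_range_P: "\<alpha> \<in> Field omega1 \<Longrightarrow> closed (range (P \<alpha>))"
  by (rule closed_range_idempotent) (rule P, assumption)+

lemma range_P_mono: "(\<alpha>, \<beta>) \<in> omega1 \<Longrightarrow> range (P \<alpha>) \<subseteq> range (P \<beta>)"
  using PRI unfolding projectional_resolution_def by (metis UNIV_I image_subsetI rangeI)

lemma least_\<E>:
  assumes "\<D> \<subseteq> \<E>" "\<D> \<noteq> {}"
  shows "\<exists>G\<in>\<D>. \<forall>H\<in>\<D>. G \<subseteq> H"
proof -
  interpret W: wo_rel omega1 by (rule wo_rel.intro[OF Well_order_omega1])
  let ?A = "{\<alpha> \<in> Field omega1. range (P \<alpha>) \<in> \<D>}"
  have A: "?A \<subseteq> Field omega1" "?A \<noteq> {}" using assms unfolding \<E>_def by auto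
  show ?thesis
  proof (intro bexI ballI)
    show "range (P (W.minim ?A)) \<in> \<D>" using W.minim_in[OF A] by simp
    fix H assume "H \<in> \<D>"
    then have "H \<in> \<E>" using assms(1) by (rule subsetD[rotated])
    then obtain \<beta> where "\<beta> \<in> ?A" "H = range (P \<beta>)" using \<open>H \<in> \<D>\<close> by (auto elim!: \<E>E)
    then show "range (P (W.minim ?A)) \<subseteq> H" using W.minim_least[OF A(1)] range_P_mono by simp
  qed
qed

text \<open>
  Let \<open>\<delta>\<close> be the least ordinal whose range contains the union. Unless this range itself belongs to
  the family, \<open>\<delta>\<close> is a limit and the family is cofinal below \<open>\<delta>\<close>, so continuity of the resolution
  at \<open>\<delta>\<close> gives the result.
\<close>
lemma closure_Union_\<E>:
  assumes "\<D> \<subseteq> \<E>" "\<D> \<noteq> {}" "U \<in> \<E>" "\<Union>\<D> \<subseteq> U"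
  shows "closure (\<Union>\<D>) \<in> \<E>"
proof -
  interpret W: wo_rel omega1 by (rule wo_rel.intro[OF Well_order_omega1])
  let ?X = "{\<alpha> \<in> Field omega1. \<Union>\<D> \<subseteq> range (P \<alpha>)}"
  have X: "?X \<subseteq> Field omega1" "?X \<noteq> {}" using assms(3,4) by (auto elim!: \<E>E)
  define \<delta> where "\<delta> = W.minim ?X"
  have \<delta>: "\<delta> \<in> Field omega1" "\<Union>\<D> \<subseteq> range (P \<delta>)" using W.minim_in[OF X] unfolding \<delta>_def by auto
  have \<delta>_le: "(\<delta>, \<alpha>) \<in> omega1" if "\<alpha> \<in> Field omega1" "\<Union>\<D> \<subseteq> range (P \<alpha>)" for \<alpha>
    using W.minim_least[OF X(1)] that unfolding \<delta>_def by auto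
  have sub: "closure (\<Union>\<D>) \<subseteq> range (P \<delta>)"
    by (rule closure_minimal[OF \<delta>(2) closed_range_P[OF \<delta>(1)]])
  show ?thesis
  proof (cases "range (P \<delta>) \<in> \<D>")
    case True
    then have "range (P \<delta>) \<subseteq> closure (\<Union>\<D>)" by (rule order_trans[OF Sup_upper closure_subset])
    then show ?thesis using sub \<E>I[OF \<delta>(1)] by (simp add: subset_antisym)
  next
    case False
    have below: "\<eta> \<in> underS omega1 \<delta>" if \<eta>: "\<eta> \<in> Field omega1" "range (P \<eta>) \<in> \<D>" for \<eta>
    proof -
      have "range (P \<eta>) \<subseteq> range (P \<delta>)" using Sup_upper[OF \<eta>(2)] \<delta>(2) by (rule order_trans)
      then have "\<not> range (P \<delta>) \<subseteq> range (P \<eta>)" using \<eta>(2) False by (metis subset_antisym)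
      then have "(\<delta>, \<eta>) \<notin> omega1" "\<eta> \<noteq> \<delta>" using range_P_mono by blast+
      moreover have "(\<eta>, \<delta>) \<in> omega1 \<or> (\<delta>, \<eta>) \<in> omega1" using W.TOTALS \<eta>(1) \<delta>(1) by blast
      ultimately show ?thesis by (simp add: underS_def)
    qed
    have above: "\<exists>\<eta>\<in>Field omega1. range (P \<eta>) \<in> \<D> \<and> \<xi> \<in> underS omega1 \<eta>"
      if "\<xi> \<in> underS omega1 \<delta>" for \<xi>
    proof -
      have \<xi>: "\<xi> \<noteq> \<delta>" "(\<xi>, \<delta>) \<in> omega1" "\<xi> \<in> Field omega1" using that by (auto simp: underS_def Field_def)
      then have "\<not> \<Union>\<D> \<subseteq> range (P \<xi>)" using \<delta>_le antisymD[OF W.ANTISYM] by blast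
      then obtain D where D: "D \<in> \<D>" "\<not> D \<subseteq> range (P \<xi>)" by blast
      have "D \<in> \<E>" using assms(1) D(1) by (rule subsetD)
      then obtain \<eta> where \<eta>: "\<eta> \<in> Field omega1" "D = range (P \<eta>)" by (rule \<E>E)
      have "(\<eta>, \<xi>) \<notin> omega1" "\<xi> \<noteq> \<eta>" using D(2) \<eta>(2) range_P_mono by blast+
      moreover have "(\<xi>, \<eta>) \<in> omega1 \<or> (\<eta>, \<xi>) \<in> omega1" using W.TOTALS \<eta>(1) \<xi>(3) by blast
      ultimately have "\<xi> \<in> underS omega1 \<eta>" by (simp add: underS_def)
      then show ?thesis using \<eta> D(1) by blast
    qed
    obtain D where "D \<in> \<D>" using assms(2) by auto
    moreover from this have "D \<in> \<E>" using assms(1) by (rule subsetD[rotated])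
    ultimately have "underS omega1 \<delta> \<noteq> {}" using below by (auto elim!: \<E>E)
    then have "is_limit omega1 \<delta>" unfolding is_limit_def using \<delta>(1) above below by blast
    then have "range (P \<delta>) = closure (\<Union>\<xi>\<in>underS omega1 \<delta>. range (P \<xi>))"
      using PRI unfolding projectional_resolution_def by blast
    also have "\<dots> \<subseteq> closure (\<Union>\<D>)"
    proof (rule closure_mono, rule UN_least)
      fix \<xi> assume "\<xi> \<in> underS omega1 \<delta>"
      from above[OF this] obtain \<eta> where "range (P \<eta>) \<in> \<D>" "(\<xi>, \<eta>) \<in> omega1"
        by (auto simp: underS_def)
      then show "range (P \<xi>) \<subseteq> \<Union>\<D>" using range_P_mono by blast
    qed
    finally show ?thesis using sub \<E>I[OF \<delta>(1)] by (simp add: subset_antisym)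
  qed
qed

text \<open>This is regularity of \<open>\<omega>\<^sub>1\<close>: an increasing \<open>\<omega>\<^sub>1\<close>-union absorbs a countable set at some stage.\<close>
lemma separable_subset_\<E>:
  assumes "countable D" "X \<subseteq> closure D"
  shows "\<exists>G\<in>\<E>. X \<subseteq> G"
proof -
  have "\<exists>\<alpha>\<in>Field omega1. D \<subseteq> range (P \<alpha>)"
  proof (rule cardSuc_UNION[OF natLeq_Card_order])
    show "infinite (Field natLeq)" by (simp add: Field_natLeq)
    show "relChain omega1 (\<lambda>\<alpha>. range (P \<alpha>))" unfolding relChain_def using range_P_mono by blast
    show "D \<subseteq> (\<Union>\<alpha>\<in>Field omega1. range (P \<alpha>))"
      using PRI unfolding projectional_resolution_def by blast
    show "|D| \<le>o natLeq"
      using assms(1) by (simp add: countable_iff_ordLeq_natLeq)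
  qed
  then obtain \<alpha> where \<alpha>: "\<alpha> \<in> Field omega1" "D \<subseteq> range (P \<alpha>)" by auto
  then have "X \<subseteq> range (P \<alpha>)" using assms(2) closure_minimal closed_range_P by blast
  then show ?thesis using \<E>I[OF \<alpha>(1)] by blast
qed

lemma dense_\<E>:
  assumes "G \<in> \<E>"
  shows "\<exists>D. countable D \<and> G \<subseteq> closure D"
proof -
  obtain \<alpha> where "\<alpha> \<in> Field omega1" "G = range (P \<alpha>)" using assms by (rule \<E>E)
  then show ?thesis using P(4) separable_space_iff[of G] by auto
qed

lemma closed_\<E>: "G \<in> \<E> \<Longrightarrow> closed G"
  using closed_range_P by (auto elim!: \<E>E)

lemma image_closure_Union:
  "R ` closure (\<Union>\<D>) \<subseteq> closure (\<Union>((`) R ` \<D>))"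
proof -
  have "R ` closure (\<Union>\<D>) \<subseteq> closure (R ` \<Union>\<D>)"
    by (rule continuous_image_closure_subset[of UNIV]) (auto intro: linear_continuous_on R)
  then show ?thesis by (simp add: image_Union)
qed

text \<open>
  The vector \<open>x0\<close>, later a nonzero element of \<open>F\<close>, keeps the traces from being trivial; the
  operator norm of a projection in a resolution has to be equal to \<open>1\<close>.
\<close>
definition invariant :: "'a \<Rightarrow> 'a set set" where
  "invariant x0 = {G \<in> \<E>. R ` G \<subseteq> G \<and> x0 \<in> G}"

lemma invariantD:
  assumes "G \<in> invariant x0"
  shows "G \<in> \<E>" "R ` G \<subseteq> G" "x0 \<in> G"
  using assms unfolding invariant_def by simp_all

lemma invariant_subset: "invariant x0 \<subseteq> \<E>"
  unfolding invariant_def by (rule Collect_restrict)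

lemma closure_Union_invariant:
  assumes "\<D> \<subseteq> invariant x0" "\<D> \<noteq> {}" "U \<in> \<E>" "\<Union>\<D> \<subseteq> U"
  shows "closure (\<Union>\<D>) \<in> invariant x0"
proof -
  have "closure (\<Union>\<D>) \<in> \<E>"
    by (rule closure_Union_\<E>[OF order_trans[OF assms(1) invariant_subset] assms(2-4)])
  moreover have "\<Union>((`) R ` \<D>) \<subseteq> \<Union>\<D>"
  proof (rule Union_least)
    fix X assume "X \<in> (`) R ` \<D>"
    then obtain G where G: "G \<in> \<D>" "X = R ` G" by auto
    then have "R ` G \<subseteq> G" using assms(1) by (intro invariantD(2)) auto
    then show "X \<subseteq> \<Union>\<D>" using G by auto
  qed
  then have "R ` closure (\<Union>\<D>) \<subseteq> closure (\<Union>\<D>)"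
    using image_closure_Union closure_mono by (metis order_trans)
  moreover obtain G where "G \<in> \<D>" using assms(2) by auto
  then have "x0 \<in> \<Union>\<D>" using invariantD(3) assms(1) by blast
  then have "x0 \<in> closure (\<Union>\<D>)" using closure_subset by (rule subsetD[rotated])
  ultimately show ?thesis unfolding invariant_def by simp
qed

text \<open>
  Closing off: enlarge a range repeatedly to one that also contains \<open>x0\<close> and its image under \<open>R\<close>. The
  closed union of these countably many ranges is invariant, and it is again a range of the
  resolution because it is separable, hence bounded.
\<close>
lemma invariant_cofinal:
  assumes "G \<in> \<E>"
  shows "\<exists>H\<in>invariant x0. G \<subseteq> H"
proof -
  have step: "\<exists>H\<in>\<E>. G \<union> R ` G \<union> {x0} \<subseteq> H" if G: "G \<in> \<E>" for G
  proof -
    obtain D where D: "countable D" "G \<subseteq> closure D" using dense_\<E>[OF G] by auto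
    have "R ` closure D \<subseteq> closure (R ` D)"
      by (rule continuous_image_closure_subset[of UNIV]) (auto intro: linear_continuous_on R)
    then have "G \<union> R ` G \<union> {x0} \<subseteq> closure (D \<union> R ` D \<union> {x0})"
    proof -
      have "closure D \<subseteq> closure (D \<union> R ` D \<union> {x0})" "closure (R ` D) \<subseteq> closure (D \<union> R ` D \<union> {x0})"
        by (rule closure_mono, blast)+
      moreover have "x0 \<in> closure (D \<union> R ` D \<union> {x0})" by (rule subsetD[OF closure_subset]) simp
      ultimately show ?thesis using D(2) \<open>R ` closure D \<subseteq> closure (R ` D)\<close> by blast
    qed
    moreover have "countable (D \<union> R ` D \<union> {x0})" using D(1) by auto
    ultimately show ?thesis using separable_subset_\<E> by blast
  qed
  then have "\<forall>G\<in>\<E>. \<exists>H. H \<in> \<E> \<and> G \<union> R ` G \<union> {x0} \<subseteq> H" by (metis (no_types))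
  from bchoice[OF this] obtain h where "\<forall>G\<in>\<E>. h G \<in> \<E> \<and> G \<union> R ` G \<union> {x0} \<subseteq> h G" ..
  then have h: "h G \<in> \<E>" "G \<union> R ` G \<union> {x0} \<subseteq> h G" if "G \<in> \<E>" for G
    using that by simp_all
  define g where "g n = (h ^^ n) G" for n
  have g: "g n \<in> \<E>" for n by (induction n) (simp_all add: g_def assms h(1))
  have g_0: "g 0 = G" by (simp add: g_def)
  have Suc: "g n \<union> R ` g n \<union> {x0} \<subseteq> g (Suc n)" for n using h(2)[OF g[of n]] by (simp add: g_def)
  obtain d where d: "\<And>n. countable (d n)" "\<And>n. g n \<subseteq> closure (d n)" using dense_\<E>[OF g] by metis
  have "(\<Union>n. g n) \<subseteq> closure (\<Union>n. d n)"
    by (intro UN_least order_trans[OF d(2)] closure_mono) auto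
  moreover have "countable (\<Union>n. d n)" using d(1) by auto
  ultimately have "\<exists>U\<in>\<E>. (\<Union>n. g n) \<subseteq> U" by (intro separable_subset_\<E>)
  then obtain U where U: "U \<in> \<E>" "(\<Union>n. g n) \<subseteq> U" by (rule bexE)
  let ?H = "closure (\<Union>n. g n)"
  have "?H \<in> \<E>" by (rule closure_Union_\<E>[OF _ _ U]) (use g in auto)
  moreover have "closure (\<Union>n. R ` g n) \<subseteq> ?H"
    by (intro closure_mono UN_least) (use Suc in blast)
  then have "R ` ?H \<subseteq> ?H" using image_closure_Union[of "range g"] by (simp add: image_image)
  moreover have "g n \<subseteq> ?H" for n by (rule order_trans[OF _ closure_subset]) auto
  from this[of 0] this[of "Suc 0"] have "x0 \<in> ?H" "G \<subseteq> ?H" using Suc[of 0] by (auto simp: g_0)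
  ultimately have "?H \<in> invariant x0" "G \<subseteq> ?H" unfolding invariant_def by simp_all
  then show ?thesis by (rule bexI[rotated])
qed

section \<open>The chain of traces\<close>

definition traces :: "'a \<Rightarrow> 'a set set" where
  "traces x0 = (\<lambda>G. range R \<inter> G) ` invariant x0"

lemma traces_subset: "H \<in> traces x0 \<Longrightarrow> H \<subseteq> range R"
  unfolding traces_def by blast

lemma fixed_R: "x \<in> range R \<Longrightarrow> R x = x" using R(2) by auto

lemma closed_range_R: "closed (range R)"
  by (rule closed_range_idempotent) (rule R)+

text \<open>
  A vector \<open>x\<close> of the left side equals \<open>R x\<close>, and \<open>R\<close> maps approximations of \<open>x\<close> from members of \<open>\<D>\<close>
  to approximations from their traces.
\<close>
lemma trace_closure_Union:
  assumes "\<D> \<subseteq> invariant x0"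
  shows "range R \<inter> closure (\<Union>\<D>) = closure (\<Union>G\<in>\<D>. range R \<inter> G)"
proof
  show "range R \<inter> closure (\<Union>\<D>) \<subseteq> closure (\<Union>G\<in>\<D>. range R \<inter> G)"
  proof
    fix x assume x: "x \<in> range R \<inter> closure (\<Union>\<D>)"
    then have "x \<in> R ` closure (\<Union>\<D>)" using fixed_R by (metis IntE image_eqI)
    then have "x \<in> closure (\<Union>((`) R ` \<D>))" using image_closure_Union by blast
    moreover have "\<Union>((`) R ` \<D>) \<subseteq> (\<Union>G\<in>\<D>. range R \<inter> G)"
      using invariantD(2)[of _ x0] assms by (intro Union_least) blast
    ultimately show "x \<in> closure (\<Union>G\<in>\<D>. range R \<inter> G)" using closure_mono by blast
  qed
  show "closure (\<Union>G\<in>\<D>. range R \<inter> G) \<subseteq> range R \<inter> closure (\<Union>\<D>)"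
    by (intro closure_minimal closed_Int closed_range_R closed_closure)
      (use closure_subset[of "\<Union>\<D>"] in blast)
qed

lemma invariant_chain: "\<lbrakk>G \<in> invariant x0; H \<in> invariant x0\<rbrakk> \<Longrightarrow> G \<subseteq> H \<or> H \<subseteq> G"
  using least_\<E>[of "{G, H}"] invariantD(1)[of _ x0] by auto

text \<open>
  Different invariant ranges can have the same trace \<open>H\<close>; an ordinal is chosen for which
  \<open>R P\<^sub>\<alpha>\<close> is a projection onto \<open>H\<close>.
\<close>
definition index :: "'a set \<Rightarrow> nat set" where
  "index H = (SOME \<alpha>. \<alpha> \<in> Field omega1 \<and> H \<subseteq> range (P \<alpha>) \<and> R ` range (P \<alpha>) \<subseteq> H)"

lemma index:
  assumes "H \<in> traces x0"
  shows "index H \<in> Field omega1" "H \<subseteq> range (P (index H))" "R ` range (P (index H)) \<subseteq> H"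
proof -
  have "\<exists>\<alpha>. \<alpha> \<in> Field omega1 \<and> H \<subseteq> range (P \<alpha>) \<and> R ` range (P \<alpha>) \<subseteq> H"
  proof -
    obtain G where G: "G \<in> invariant x0" "H = range R \<inter> G" using assms unfolding traces_def by auto
    obtain \<alpha> where "\<alpha> \<in> Field omega1" "G = range (P \<alpha>)" using invariantD(1)[OF G(1)] by (rule \<E>E)
    then show ?thesis using G(2) invariantD(2)[OF G(1)] by blast
  qed
  from someI_ex[OF this]
  show "index H \<in> Field omega1" "H \<subseteq> range (P (index H))" "R ` range (P (index H)) \<subseteq> H"
    unfolding index_def by auto
qed

text \<open>
  A family of traces is the image of the family of all invariant ranges with a trace in it. If
  the traces are bounded by the trace \<open>U\<close> of \<open>V\<close>, these ranges are bounded by \<open>V\<close> unless \<open>U\<close> itself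
  belongs to the family.
\<close>
lemma contractive_chain_traces:
  "contractive_chain (traces x0) (\<lambda>H. R \<circ> P (index H))"
proof (rule contractive_chain.intro)
  fix \<D> assume D: "\<D> \<subseteq> traces x0" "\<D> \<noteq> {}"
  let ?D = "{G \<in> invariant x0. range R \<inter> G \<in> \<D>}"
  have ne: "?D \<noteq> {}" and D_eq: "\<D> = (\<lambda>G. range R \<inter> G) ` ?D" using D unfolding traces_def by auto
  have "?D \<subseteq> \<E>" using invariantD(1) by auto
  then have "\<exists>G\<in>?D. \<forall>H\<in>?D. G \<subseteq> H" using ne by (rule least_\<E>)
  then obtain G where G: "G \<in> ?D" "\<forall>H\<in>?D. G \<subseteq> H" by (rule bexE)
  have "range R \<inter> G \<subseteq> H" if "H \<in> \<D>" for H
  proof -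
    have "H \<in> (\<lambda>G. range R \<inter> G) ` ?D" using that D_eq by simp
    then show ?thesis using G(2) by auto
  qed
  then show "\<exists>G\<in>\<D>. \<forall>H\<in>\<D>. G \<subseteq> H" using G(1) by blast
  fix U assume U: "U \<in> traces x0" "\<Union>\<D> \<subseteq> U"
  then obtain V where V: "V \<in> invariant x0" "U = range R \<inter> V" unfolding traces_def by auto
  show "closure (\<Union>\<D>) \<in> traces x0"
  proof (cases "U \<in> \<D>")
    case True
    then have "\<Union>\<D> = U" using U(2) by blast
    moreover have "closed U"
      unfolding V(2) by (intro closed_Int closed_range_R closed_\<E> invariantD(1)[OF V(1)])
    ultimately show ?thesis using U(1) by simp
  next
    case False
    have "G \<subseteq> V" if "G \<in> ?D" for G
    proof (rule ccontr)
      assume "\<not> G \<subseteq> V"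
      then have "V \<subseteq> G" using invariant_chain[of G x0 V] V(1) that by auto
      moreover have "range R \<inter> G \<subseteq> U" using U(2) that by blast
      ultimately have "range R \<inter> G = U" using V(2) by blast
      then show False using False that by simp
    qed
    then have "closure (\<Union>?D) \<in> invariant x0"
      by (intro closure_Union_invariant[OF _ ne invariantD(1)[OF V(1)]]) auto
    then have "range R \<inter> closure (\<Union>?D) \<in> traces x0" unfolding traces_def by blast
    moreover have "range R \<inter> closure (\<Union>?D) = closure (\<Union>\<D>)"
      using trace_closure_Union[of ?D x0] D_eq by auto
    ultimately show ?thesis by simp
  qed
next
  fix H x assume H: "H \<in> traces x0"
  show "linear (R \<circ> P (index H))"
    by (intro linear_compose bounded_linear.linear P index[OF H] R)
  show "(R \<circ> P (index H)) x \<in> H"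
    unfolding comp_apply by (intro subsetD[OF index(3)[OF H]] imageI rangeI)
  show "norm ((R \<circ> P (index H)) x) \<le> norm x"
    unfolding comp_apply by (rule order_trans[OF R(3) P(3)[OF index(1)[OF H]]])
next
  fix H x assume H: "H \<in> traces x0" "x \<in> H"
  obtain z where "x = P (index H) z" using subsetD[OF index(2)[OF H(1)] H(2)] by (rule rangeE)
  then have "P (index H) x = x" using P(2)[OF index(1)[OF H(1)]] by simp
  moreover have "R x = x" by (rule fixed_R[OF subsetD[OF traces_subset[OF H(1)] H(2)]])
  ultimately show "(R \<circ> P (index H)) x = x" by simp
qed

lemma Union_traces: "\<Union>(traces x0) = range R"
proof -
  have "x \<in> \<Union>(traces x0)" if "x \<in> range R" for x
  proof -
    obtain G where G: "G \<in> \<E>" "x \<in> G"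
      using PRI unfolding projectional_resolution_def \<E>_def by blast
    from invariant_cofinal[OF G(1)] obtain H where "H \<in> invariant x0" "G \<subseteq> H" by blast
    then show ?thesis using G(2) that unfolding traces_def by blast
  qed
  then show ?thesis unfolding traces_def by blast
qed

lemma separable_trace:
  assumes "H \<in> traces x0"
  shows "separable_space (top_of_set H)"
proof -
  have "H \<subseteq> R ` range (P (index H))"
  proof
    fix x assume x: "x \<in> H"
    have "x = R x" using fixed_R[OF subsetD[OF traces_subset[OF assms] x]] by (rule sym)
    moreover have "x \<in> range (P (index H))" by (rule subsetD[OF index(2)[OF assms] x])
    ultimately show "x \<in> R ` range (P (index H))" by (rule image_eqI)
  qed
  then have "H = R ` range (P (index H))" using index(3)[OF assms] by (rule subset_antisym)
  then show ?thesis
    using separable_image[OF P(4)[OF index(1)[OF assms]] linear_continuous_on[OF R(1)]] by metis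
qed

section \<open>The resolution of the subspace\<close>

text \<open>
  The least invariant range above the range of \<open>P \<alpha>\<close>. It may be constant on intervals of ordinals;
  repetitions are harmless in a resolution, and so no increasing enumeration of the
  invariant ranges is needed.
\<close>
definition envelope :: "'a \<Rightarrow> nat set \<Rightarrow> 'a set" where
  "envelope x0 \<alpha> = (SOME G. G \<in> invariant x0 \<and> range (P \<alpha>) \<subseteq> G
     \<and> (\<forall>H\<in>invariant x0. range (P \<alpha>) \<subseteq> H \<longrightarrow> G \<subseteq> H))"

lemma envelope:
  assumes "\<alpha> \<in> Field omega1"
  shows "envelope x0 \<alpha> \<in> invariant x0" "range (P \<alpha>) \<subseteq> envelope x0 \<alpha>"
    "\<lbrakk>H \<in> invariant x0; range (P \<alpha>) \<subseteq> H\<rbrakk> \<Longrightarrow> envelope x0 \<alpha> \<subseteq> H"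
proof -
  let ?D = "{G \<in> invariant x0. range (P \<alpha>) \<subseteq> G}"
  have "?D \<subseteq> \<E>" "?D \<noteq> {}"
    using invariantD(1) invariant_cofinal[OF \<E>I[OF assms], of x0] by auto
  then have "\<exists>G\<in>?D. \<forall>H\<in>?D. G \<subseteq> H" by (rule least_\<E>)
  then obtain G where "G \<in> ?D" "\<forall>H\<in>?D. G \<subseteq> H" by (rule bexE)
  then have "\<exists>G. G \<in> invariant x0 \<and> range (P \<alpha>) \<subseteq> G
     \<and> (\<forall>H\<in>invariant x0. range (P \<alpha>) \<subseteq> H \<longrightarrow> G \<subseteq> H)" by (intro exI[of _ G]) simp
  from someI_ex[OF this] show "envelope x0 \<alpha> \<in> invariant x0" "range (P \<alpha>) \<subseteq> envelope x0 \<alpha>"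
    "\<lbrakk>H \<in> invariant x0; range (P \<alpha>) \<subseteq> H\<rbrakk> \<Longrightarrow> envelope x0 \<alpha> \<subseteq> H"
    unfolding envelope_def by auto
qed

lemma envelope_mono:
  assumes "(\<alpha>, \<beta>) \<in> omega1"
  shows "envelope x0 \<alpha> \<subseteq> envelope x0 \<beta>"
proof -
  have "\<alpha> \<in> Field omega1" "\<beta> \<in> Field omega1" using assms by (auto simp: Field_def)
  then show ?thesis using envelope range_P_mono[OF assms] by (meson order_trans)
qed

text \<open>
  The closed union of the envelopes below \<open>\<delta>\<close> is invariant and contains the range of \<open>P \<delta>\<close> by
  continuity of the resolution, so it contains the least such range.
\<close>
lemma envelope_limit:
  assumes "is_limit omega1 \<delta>"
  shows "envelope x0 \<delta> = closure (\<Union>\<xi>\<in>underS omega1 \<delta>. envelope x0 \<xi>)"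
proof
  let ?D = "envelope x0 ` underS omega1 \<delta>"
  have \<delta>: "\<delta> \<in> Field omega1" "underS omega1 \<delta> \<noteq> {}" using assms unfolding is_limit_def by auto
  have \<xi>: "\<xi> \<in> Field omega1 \<and> (\<xi>, \<delta>) \<in> omega1" if "\<xi> \<in> underS omega1 \<delta>" for \<xi>
    using that by (auto simp: underS_def Field_def)
  have D: "?D \<subseteq> invariant x0" "\<Union>?D \<subseteq> envelope x0 \<delta>"
    using \<xi> envelope(1) envelope_mono by blast+
  have \<delta>E: "envelope x0 \<delta> \<in> \<E>" by (rule invariantD(1)[OF envelope(1)[OF \<delta>(1)]])
  show "closure (\<Union>?D) \<subseteq> envelope x0 \<delta>" by (rule closure_minimal[OF D(2) closed_\<E>[OF \<delta>E]])
  have "closure (\<Union>?D) \<in> invariant x0"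
    using closure_Union_invariant[OF D(1) _ \<delta>E D(2)] \<delta>(2) by blast
  moreover have "range (P \<delta>) = closure (\<Union>\<xi>\<in>underS omega1 \<delta>. range (P \<xi>))"
    using PRI assms unfolding projectional_resolution_def by blast
  moreover have "closure (\<Union>\<xi>\<in>underS omega1 \<delta>. range (P \<xi>)) \<subseteq> closure (\<Union>?D)"
    by (rule closure_mono) (use \<xi> envelope(2) in blast)
  ultimately show "envelope x0 \<delta> \<subseteq> closure (\<Union>?D)" using envelope(3)[OF \<delta>(1)] by blast
qed

lemma projectional_resolution_range:
  assumes x0: "x0 \<in> range R" "x0 \<noteq> 0"
  shows "\<exists>S. projectional_resolution (range R) S"
proof -
  interpret T: contractive_chain "traces x0" "\<lambda>H. R \<circ> P (index H)"
    by (rule contractive_chain_traces)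
  note U = Union_traces[of x0]
  define G where "G \<alpha> = range R \<inter> envelope x0 \<alpha>" for \<alpha>
  have G: "G \<alpha> \<in> traces x0" "x0 \<in> G \<alpha>" if "\<alpha> \<in> Field omega1" for \<alpha>
    using envelope(1)[OF that, of x0] invariantD(3) x0(1) unfolding G_def traces_def by auto
  have G_mono: "G \<alpha> \<subseteq> G \<beta>" if "(\<alpha>, \<beta>) \<in> omega1" for \<alpha> \<beta>
    using envelope_mono[OF that] unfolding G_def by blast
  have image: "T.proj (G \<alpha>) ` range R = G \<alpha>" if "\<alpha> \<in> Field omega1" for \<alpha>
  proof
    show "T.proj (G \<alpha>) ` range R \<subseteq> G \<alpha>" using T.proj(1)[OF G(1)[OF that]] U by auto
    show "G \<alpha> \<subseteq> T.proj (G \<alpha>) ` range R"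
    proof
      fix x assume x: "x \<in> G \<alpha>"
      have "x = T.proj (G \<alpha>) x" using T.proj_fixed[OF G(1)[OF that] x] by simp
      moreover have "x \<in> range R" using x unfolding G_def by (rule IntD1)
      ultimately show "x \<in> T.proj (G \<alpha>) ` range R" by (rule image_eqI)
    qed
  qed
  have G_limit: "G \<delta> = closure (\<Union>\<xi>\<in>underS omega1 \<delta>. G \<xi>)" if "is_limit omega1 \<delta>" for \<delta>
  proof -
    have "envelope x0 ` underS omega1 \<delta> \<subseteq> invariant x0"
      using envelope(1) by (auto simp: underS_def Field_def)
    from trace_closure_Union[OF this] show ?thesis
      by (simp add: G_def envelope_limit[OF that])
  qed
  have cover: "range R = (\<Union>\<alpha>\<in>Field omega1. G \<alpha>)"
  proof -
    have "x \<in> (\<Union>\<alpha>\<in>Field omega1. G \<alpha>)" if "x \<in> range R" for x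
    proof -
      obtain \<alpha> where "\<alpha> \<in> Field omega1" "x \<in> range (P \<alpha>)"
        using PRI unfolding projectional_resolution_def by blast
      then show ?thesis using that envelope(2) unfolding G_def by blast
    qed
    then show ?thesis unfolding G_def by blast
  qed
  have "projectional_resolution (range R) (\<lambda>\<alpha>. T.proj (G \<alpha>))"
    unfolding projectional_resolution_def
  proof (intro conjI ballI allI impI)
    fix \<alpha> assume \<alpha>: "\<alpha> \<in> Field omega1"
    note T = G(1)[OF \<alpha>]
    have Gr: "G \<alpha> \<subseteq> range R" unfolding G_def by auto
    show "bounded_linear_op_on (range R) (T.proj (G \<alpha>))"
      unfolding bounded_linear_op_on_def
      using image[OF \<alpha>] Gr T.proj_add[OF T] T.proj_scale[OF T] T.norm_proj[OF T] U
      by (auto intro!: exI[of _ 1])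
    show "T.proj (G \<alpha>) (T.proj (G \<alpha>) x) = T.proj (G \<alpha>) x" if "x \<in> range R" for x
      using T.proj_proj(1)[OF T T] that U by simp
    show "separable_space (top_of_set (T.proj (G \<alpha>) ` range R))"
      using separable_trace[OF T] image[OF \<alpha>] by simp
    show "onorm_on (range R) (T.proj (G \<alpha>)) = 1"
      using onorm_on_eq_1[of "range R" "T.proj (G \<alpha>)" x0] T.norm_proj[OF T] U x0
        T.proj_fixed[OF T G(2)[OF \<alpha>]] by simp
  next
    fix \<alpha> \<beta> x assume le: "(\<alpha>, \<beta>) \<in> omega1" and x: "x \<in> range R"
    then have "\<alpha> \<in> Field omega1" "\<beta> \<in> Field omega1" by (auto simp: Field_def)
    then show "T.proj (G \<alpha>) x = T.proj (G \<alpha>) (T.proj (G \<beta>) x)"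
      "T.proj (G \<alpha>) x = T.proj (G \<beta>) (T.proj (G \<alpha>) x)"
      using T.proj_proj[OF G(1) G(1) G_mono[OF le]] x U by simp_all
  next
    show "range R = (\<Union>\<alpha>\<in>Field omega1. T.proj (G \<alpha>) ` range R)"
      using cover image by simp
  next
    fix \<delta> assume lim: "is_limit omega1 \<delta>"
    have "\<xi> \<in> Field omega1" if "\<xi> \<in> underS omega1 \<delta>" for \<xi>
      using that by (auto simp: underS_def Field_def)
    then show "T.proj (G \<delta>) ` range R = closure (\<Union>\<xi>\<in>underS omega1 \<delta>. T.proj (G \<xi>) ` range R)"
      using G_limit[OF lim, symmetric] image[of \<delta>] image lim unfolding is_limit_def
      by (simp cong: SUP_cong)
  qed
  then show ?thesis by blast
qed

end

theorem theorem6p3: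
  fixes F :: "'a::banach set"
  assumes "has_density (UNIV :: 'a set) omega1"
    and "one_Plichko (UNIV :: 'a set)"
    and "one_complemented F"
  shows "one_Plichko F"
proof -
  obtain R where F: "subspace F" "range R = F"
    and R: "bounded_linear R" "R \<circ> R = R" "onorm R \<le> 1"
    using assms(3) unfolding one_complemented_def by blast
  have RR: "R (R x) = R x" for x using R(2) by (metis comp_apply)
  have norm_R: "norm (R x) \<le> norm x" for x
    using onorm[OF R(1), of x] mult_right_mono[OF R(3) norm_ge_zero[of x]] by simp
  have closed: "closed F"
    unfolding F(2)[symmetric] by (rule closed_range_idempotent) (rule R(1), rule RR)
  show ?thesis
  proof (cases "separable_space (top_of_set F)")
    case True
    then show ?thesis using F closed unfolding one_Plichko_def by simp
  next
    case False
    then have "\<not> separable_space (top_of_set (UNIV :: 'a set))"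
      using separable_image[OF _ linear_continuous_on[OF R(1)], of UNIV] F(2) by auto
    then obtain P where "projectional_resolution (UNIV :: 'a set) P"
      using assms(2) unfolding one_Plichko_def by blast
    then interpret resolution_and_projection P R
      by (rule resolution_and_projection.intro[OF _ R(1) RR norm_R])
    have "separable_space (top_of_set {0::'a})"
      unfolding separable_space_iff by (intro exI[of _ "{0}"]) auto
    then have "F \<noteq> {0}" using False by auto
    then obtain x0 where "x0 \<in> F" "x0 \<noteq> 0" using subspace_0[OF F(1)] by auto
    then have "\<exists>S. projectional_resolution F S" using projectional_resolution_range F(2) by blast
    moreover have "has_density F omega1"
      by (rule has_density_omega1_nonseparable_image[OF assms(1) linear_continuous_on[OF R(1)] F(2) False])
    ultimately show ?thesis using F closed unfolding one_Plichko_def by blast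
  qed
qed

end
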